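(* Let $R$ be a finite noncommutative ring such that $|R|\notin\{8,12\}$. Then the noncommuting graph of $R$ is $2$-regular if and only if $R$ is isomorphic to $E(4)$ or $F(4)$.
   Context: Rings are associative and not assumed to have a unity. $Z(R)$ is the center of $R$. The noncommuting graph of a finite noncommutative ring $R$ is the simple undirected graph with vertex set $R\setminus Z(R)$ in which two vertices $x,y$ are adjacent if and only if $xy\neq yx$. For a prime $p$, $E(p^2)=\langle a,b: pa=pb=0,\ a^2=a,\ b^2=b,\ ab=a,\ ba=b\rangle$ and $F(p^2)=\langle x,y: px=py=0,\ x^2=x,\ y^2=y,\ xy=y,\ yx=x\rangle$; these are (non-unital) rings of order $p^2$ whose additive group is free over $\mathbb{Z}/p$ on the two generators, with multiplication determined bilinearly by the given relations. *)

theory Defs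
  imports "HOL-Library.Numeral_Type" "Graph_Theory.Pair_Digraph"
begin

text \<open>
  The type class \<^class>\<open>ring\<close> is the class of associative rings without any assumption of a unity,
  so a finite ring is a type of class \<^class>\<open>ring\<close> and \<^class>\<open>finite\<close>.
\<close>

definition ring_center :: "'a::ring set"
  where "ring_center = {z. \<forall>x. z * x = x * z}"

definition ring_isomorphism :: "('a::ring \<Rightarrow> 'b::ring) \<Rightarrow> bool"
  where "ring_isomorphism f \<longleftrightarrow>
    bij f \<and> (\<forall>x y. f (x + y) = f x + f y) \<and> (\<forall>x y. f (x * y) = f x * f y)"


section \<open>The noncommuting graph\<close>

text \<open>
  A simple undirected graph is a symmetric loop-free digraph without parallel arcs
  (\<^locale>\<open>pair_graph\<close>); the undirected edge joining u and v is the pair of arcs (u, v), (v, u),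
  and the degree of a vertex is its out-degree.
\<close>

definition noncommuting_graph :: "'a::ring pair_pre_digraph"
  where "noncommuting_graph =
    \<lparr> pverts = UNIV - ring_center,
      parcs = {(x, y). x \<in> UNIV - ring_center \<and> y \<in> UNIV - ring_center \<and> x * y \<noteq> y * x} \<rparr>"

lemma pair_graph_noncommuting_graph:
  "pair_graph (noncommuting_graph :: 'a::{finite, ring} pair_pre_digraph)"
  by unfold_locales (auto simp: noncommuting_graph_def symmetric_def intro!: symI)

definition regular_graph :: "nat \<Rightarrow> 'a pair_pre_digraph \<Rightarrow> bool"
  where "regular_graph k G \<longleftrightarrow> (\<forall>v \<in> pverts G. out_degree (with_proj G) v = k)"


section \<open>The rings E and F\<close>

text \<open>
  The ring \<open>'k E_ring\<close> is the free module over \<open>'k\<close> on a, b, where \<open>E_elem i j\<close> stands for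
  i a + j b. The product is the bilinear extension of aa = a, ab = a, ba = b, bb = b.
  Instantiating \<open>'k\<close> with the numeral type p (the integers mod p) gives the ring E of order
  \<open>p ^ 2\<close>; in particular the ring of order 4 is \<open>2 E_ring\<close>.
\<close>

datatype 'k E_ring = E_elem 'k 'k

instantiation E_ring :: (ring) ring
begin

definition zero_E_ring :: "'a E_ring" where "0 = E_elem 0 0"

fun plus_E_ring :: "'a E_ring \<Rightarrow> 'a E_ring \<Rightarrow> 'a E_ring"
  where "E_elem i j + E_elem k l = E_elem (i + k) (j + l)"

fun uminus_E_ring :: "'a E_ring \<Rightarrow> 'a E_ring"
  where "- E_elem i j = E_elem (- i) (- j)"

fun minus_E_ring :: "'a E_ring \<Rightarrow> 'a E_ring \<Rightarrow> 'a E_ring"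
  where "E_elem i j - E_elem k l = E_elem (i - k) (j - l)"

fun times_E_ring :: "'a E_ring \<Rightarrow> 'a E_ring \<Rightarrow> 'a E_ring"
  where "E_elem i j * E_elem k l = E_elem (i * k + i * l) (j * k + j * l)"

instance
proof
  fix x y z :: "'a E_ring"
  show "x + y + z = x + (y + z)" "x + y = y + x" "0 + x = x" "- x + x = 0" "x - y = x + - y"
    "x * y * z = x * (y * z)" "(x + y) * z = x * z + y * z" "x * (y + z) = x * y + x * z"
    by (cases x; cases y; cases z; simp add: zero_E_ring_def algebra_simps)+
qed

end

lemma E_ring_relations:
  defines "a \<equiv> E_elem (1::'k::comm_ring_1) 0" and "b \<equiv> E_elem (0::'k) 1"
  shows "a * a = a" "b * b = b" "a * b = a" "b * a = b"
  by (simp_all add: a_def b_def)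

text \<open>
  Likewise \<open>F_elem i j\<close> stands for i x + j y, and the product is the bilinear extension of
  xx = x, xy = y, yx = x, yy = y.
\<close>

datatype 'k F_ring = F_elem 'k 'k

instantiation F_ring :: (ring) ring
begin

definition zero_F_ring :: "'a F_ring" where "0 = F_elem 0 0"

fun plus_F_ring :: "'a F_ring \<Rightarrow> 'a F_ring \<Rightarrow> 'a F_ring"
  where "F_elem i j + F_elem k l = F_elem (i + k) (j + l)"

fun uminus_F_ring :: "'a F_ring \<Rightarrow> 'a F_ring"
  where "- F_elem i j = F_elem (- i) (- j)"

fun minus_F_ring :: "'a F_ring \<Rightarrow> 'a F_ring \<Rightarrow> 'a F_ring"
  where "F_elem i j - F_elem k l = F_elem (i - k) (j - l)"

fun times_F_ring :: "'a F_ring \<Rightarrow> 'a F_ring \<Rightarrow> 'a F_ring"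
  where "F_elem i j * F_elem k l = F_elem (i * k + j * k) (i * l + j * l)"

instance
proof
  fix x y z :: "'a F_ring"
  show "x + y + z = x + (y + z)" "x + y = y + x" "0 + x = x" "- x + x = 0" "x - y = x + - y"
    "x * y * z = x * (y * z)" "(x + y) * z = x * z + y * z" "x * (y + z) = x * y + x * z"
    by (cases x; cases y; cases z; simp add: zero_F_ring_def algebra_simps)+
qed

end

lemma F_ring_relations:
  defines "x \<equiv> F_elem (1::'k::comm_ring_1) 0" and "y \<equiv> F_elem (0::'k) 1"
  shows "x * x = x" "y * y = y" "x * y = y" "y * x = x"
  by (simp_all add: x_def y_def)

end

theory Submission
  imports Defs
begin

text \<open>
  If y does not commute with x, then translation by y maps the centralizer of x injectively into
  its complement, whose size is the degree of x. Since the centralizer contains 0 and x, degree 2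
  forces order 4, and conversely. In order 4, the centralizer of every non-zero x is therefore
  \<open>{0, x}\<close>; so 2 x = 0 and x x is 0 or x, at most one non-zero element squares to zero, and
  the multiplication on two idempotents is that of E or F.
\<close>

section \<open>Centralizers and vertex degrees\<close>

definition centralizer :: "'a::ring \<Rightarrow> 'a set"
  where "centralizer x = {y. x * y = y * x}"

lemma zero_in_centralizer [simp]: "0 \<in> centralizer x"
  and self_in_centralizer [simp]: "x \<in> centralizer x"
  by (simp_all add: centralizer_def)

text \<open>An element not commuting with \<open>x\<close> is itself noncentral, so it is a vertex.
  For central \<open>x\<close> both sides are 0.\<close>

lemma out_degree_noncommuting_graph:
  fixes x :: "'a::{finite, ring}"
  shows "out_degree (with_proj noncommuting_graph) x = card (- centralizer x)"
proof -
  have "out_arcs (with_proj noncommuting_graph) x = Pair x ` (- centralizer x)"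
    by (auto simp: out_arcs_def noncommuting_graph_def ring_center_def centralizer_def)
      (metis)+
  then show ?thesis
    by (simp add: out_degree_def card_image inj_on_def)
qed

lemma card_centralizer_compl:
  fixes x :: "'a::{finite, ring}"
  shows "card (centralizer x) + card (- centralizer x) = CARD('a)"
  by (metis Compl_partition Compl_disjoint card_Un_disjoint finite)

lemma card_centralizer_le_compl:
  fixes x :: "'a::{finite, ring}"
  assumes "x \<notin> ring_center"
  shows "card (centralizer x) \<le> card (- centralizer x)"
proof -
  from assms obtain y where y: "x * y \<noteq> y * x"
    by (auto simp: ring_center_def)
  \<comment> \<open>If \<open>c\<close> commutes with \<open>x\<close>, then \<open>y + c\<close>
    has the same non-zero commutator with \<open>x\<close> as \<open>y\<close>.\<close>
  have "(+) y ` centralizer x \<subseteq> - centralizer x"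
    using y by (auto simp: centralizer_def algebra_simps)
  then have "card ((+) y ` centralizer x) \<le> card (- centralizer x)"
    by (intro card_mono) auto
  then show ?thesis
    by (simp add: card_image)
qed

lemma noncentral_nonzero: "x \<notin> ring_center \<Longrightarrow> x \<noteq> 0"
  by (auto simp: ring_center_def)

lemma card_centralizer_ge:
  fixes x :: "'a::{finite, ring}"
  assumes "x \<notin> ring_center"
  shows "2 \<le> card (centralizer x)"
proof -
  have "card {0, x} \<le> card (centralizer x)"
    by (intro card_mono) auto
  then show ?thesis
    using noncentral_nonzero[OF assms] by simp
qed

lemma regular_graph_2_iff_card:
  assumes "\<exists>x y :: 'a::{finite, ring}. x * y \<noteq> y * x"
  shows "regular_graph 2 (noncommuting_graph :: 'a pair_pre_digraph) \<longleftrightarrow> CARD('a) = 4"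
proof -
  \<comment> \<open>With c and d the sizes of the centralizer and its complement, 2 \<le> c \<le> d,
    so d = 2 and c + d = 4 each force c = d = 2.\<close>
  have "card (- centralizer x) = 2 \<longleftrightarrow> CARD('a) = 4" if "x \<notin> ring_center" for x :: 'a
    using card_centralizer_ge[OF that] card_centralizer_le_compl[OF that] card_centralizer_compl[of x]
    by linarith
  \<comment> \<open>A vertex must exist, since regularity of an empty graph would be
    vacuous.\<close>
  moreover from assms obtain x :: 'a where "x \<notin> ring_center"
    by (auto simp: ring_center_def)
  ultimately show ?thesis
    by (auto simp: regular_graph_def out_degree_noncommuting_graph)
      (auto simp: noncommuting_graph_def)
qed

lemma centralizer_eq_of_card_4:
  fixes x :: "'a::{finite, ring}"
  assumes nc: "\<exists>x y :: 'a. x * y \<noteq> y * x" and card: "CARD('a) = 4" and "x \<noteq> 0"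
  shows "centralizer x = {0, x}"
proof -
  have *: "centralizer x = {0, x}" if "x \<notin> ring_center" for x :: 'a
  proof -
    have "card (centralizer x) = card {0, x}"
      using card_centralizer_ge[OF that] card_centralizer_le_compl[OF that]
        card_centralizer_compl[of x] card noncentral_nonzero[OF that] by simp
    then show ?thesis
      by (intro card_subset_eq[symmetric]) auto
  qed
  \<comment> \<open>The centre is trivial: a non-zero central \<open>x\<close> would lie in
    \<open>centralizer u = {0, u}\<close> and so equal the noncentral \<open>u\<close>.\<close>
  have "x \<notin> ring_center"
  proof
    assume x: "x \<in> ring_center"
    from nc obtain u :: 'a where u: "u \<notin> ring_center"
      by (auto simp: ring_center_def)
    have "x \<in> centralizer u"
      using x by (simp add: centralizer_def ring_center_def)
    with *[OF u] \<open>x \<noteq> 0\<close> x u show False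
      by auto
  qed
  then show ?thesis
    by (rule *)
qed

section \<open>Recognizing E(4) and F(4) from their multiplication tables\<close>

lemma UNIV_2: "(UNIV :: 2 set) = {0, 1}"
  by (rule card_subset_eq[symmetric]) simp_all

lemma cases_2:
  fixes i :: 2
  obtains "i = 0" | "i = 1"
  using UNIV_2 by blast

lemma card_E_ring: "CARD('k::finite E_ring) = CARD('k) ^ 2"
proof -
  have "bij (\<lambda>(i, j). E_elem i j :: 'k E_ring)"
    by (rule bijI) (auto simp: inj_on_def surj_def intro: E_ring.exhaust)
  from bij_betw_same_card[OF this] show ?thesis
    by (simp add: power2_eq_square)
qed

lemma card_F_ring: "CARD('k::finite F_ring) = CARD('k) ^ 2"
proof -
  have "bij (\<lambda>(i, j). F_elem i j :: 'k F_ring)"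
    by (rule bijI) (auto simp: inj_on_def surj_def intro: F_ring.exhaust)
  from bij_betw_same_card[OF this] show ?thesis
    by (simp add: power2_eq_square)
qed

lemma ring_isomorphism_card:
  fixes f :: "'a::ring \<Rightarrow> 'b::ring"
  assumes "ring_isomorphism f"
  shows "CARD('a) = CARD('b)"
  using assms bij_betw_same_card[of f UNIV UNIV] by (simp add: ring_isomorphism_def)

lemma ring_isomorphism_inv:
  assumes "ring_isomorphism f"
  shows "ring_isomorphism (inv f)"
proof -
  from assms have f: "bij f" "\<And>x y. f (x + y) = f x + f y" "\<And>x y. f (x * y) = f x * f y"
    by (auto simp: ring_isomorphism_def)
  show ?thesis
    unfolding ring_isomorphism_def
    by (intro conjI allI bij_imp_bij_inv f(1) inv_f_eq bij_is_inj)
      (simp_all add: f bij_is_surj surj_f_inv_f)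
qed

lemma card_4_UNIV:
  fixes a b :: "'a::{finite, ring}"
  assumes "CARD('a) = 4" "a \<noteq> 0" "b \<noteq> 0" "a \<noteq> b" "a + b \<noteq> 0"
  shows "(UNIV :: 'a set) = {0, a, b, a + b}"
  by (rule card_subset_eq[symmetric]) (use assms in \<open>auto simp: card_insert_if\<close>)

lemma E_ring_iso:
  fixes a b :: "'a::{finite, ring}"
  assumes U: "(UNIV :: 'a set) = {0, a, b, a + b}" and card: "CARD('a) = 4"
    and char: "\<And>x :: 'a. x + x = 0"
    and mult: "a * a = a" "b * b = b" "a * b = a" "b * a = b"
  shows "\<exists>f :: 'a \<Rightarrow> 2 E_ring. ring_isomorphism f"
proof -
  \<comment> \<open>The map starts from the model, where elements have coordinates, and is inverted
    at the end. The conditionals express the scalar multiples of \<open>a\<close> and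
    \<open>b\<close> by elements of Z/2.\<close>
  define g :: "2 E_ring \<Rightarrow> 'a" where
    "g e = (case e of E_elem i j \<Rightarrow> (if i = 0 then 0 else a) + (if j = 0 then 0 else b))" for e
  have g: "g (E_elem i j) = (if i = 0 then 0 else a) + (if j = 0 then 0 else b)" for i j
    by (simp add: g_def)
  have "{g (E_elem 0 0), g (E_elem 1 0), g (E_elem 0 1), g (E_elem 1 1)} \<subseteq> range g"
    by blast
  then have "surj g"
    using U by (auto simp: g)
  then have "bij g"
    using card by (auto intro!: bijI eq_card_imp_inj_on card_ge_0_finite simp: card_E_ring)
  moreover have char': "x + (x + y) = y" for x y :: 'a
    by (simp add: char flip: add.assoc)
  have "g (u + v) = g u + g v \<and> g (u * v) = g u * g v" for u v
  proof -
    obtain i j k l where "u = E_elem i j" "v = E_elem k l"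
      by (metis E_ring.exhaust)
    then show ?thesis
      by (cases i rule: cases_2; cases j rule: cases_2; cases k rule: cases_2; cases l rule: cases_2)
        (simp_all add: g algebra_simps char char' mult)
  qed
  ultimately have "ring_isomorphism g"
    by (simp add: ring_isomorphism_def)
  then show ?thesis
    by (blast dest: ring_isomorphism_inv)
qed

text \<open>The table is that of the opposite ring of E(4), and the argument is the same.\<close>

lemma F_ring_iso:
  fixes a b :: "'a::{finite, ring}"
  assumes U: "(UNIV :: 'a set) = {0, a, b, a + b}" and card: "CARD('a) = 4"
    and char: "\<And>x :: 'a. x + x = 0"
    and mult: "a * a = a" "b * b = b" "a * b = b" "b * a = a"
  shows "\<exists>f :: 'a \<Rightarrow> 2 F_ring. ring_isomorphism f"
proof -
  define g :: "2 F_ring \<Rightarrow> 'a" where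
    "g e = (case e of F_elem i j \<Rightarrow> (if i = 0 then 0 else a) + (if j = 0 then 0 else b))" for e
  have g: "g (F_elem i j) = (if i = 0 then 0 else a) + (if j = 0 then 0 else b)" for i j
    by (simp add: g_def)
  have "{g (F_elem 0 0), g (F_elem 1 0), g (F_elem 0 1), g (F_elem 1 1)} \<subseteq> range g"
    by blast
  then have "surj g"
    using U by (auto simp: g)
  then have "bij g"
    using card by (auto intro!: bijI eq_card_imp_inj_on card_ge_0_finite simp: card_F_ring)
  moreover have char': "x + (x + y) = y" for x y :: 'a
    by (simp add: char flip: add.assoc)
  have "g (u + v) = g u + g v \<and> g (u * v) = g u * g v" for u v
  proof -
    obtain i j k l where "u = F_elem i j" "v = F_elem k l"
      by (metis F_ring.exhaust)
    then show ?thesis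
      by (cases i rule: cases_2; cases j rule: cases_2; cases k rule: cases_2; cases l rule: cases_2)
        (simp_all add: g algebra_simps char char' mult)
  qed
  ultimately have "ring_isomorphism g"
    by (simp add: ring_isomorphism_def)
  then show ?thesis
    by (blast dest: ring_isomorphism_inv)
qed

section \<open>Classification in order 4\<close>

lemma noncommutative_ring_of_order_4:
  assumes nc: "\<exists>x y :: 'a::{finite, ring}. x * y \<noteq> y * x" and card: "CARD('a) = 4"
  shows "(\<exists>f :: 'a \<Rightarrow> 2 E_ring. ring_isomorphism f) \<or> (\<exists>f :: 'a \<Rightarrow> 2 F_ring. ring_isomorphism f)"
proof -
  have comm: "y = 0 \<or> y = x" if "x * y = y * x" "x \<noteq> 0" for x y :: 'a
    using centralizer_eq_of_card_4[OF nc card that(2)] that(1) by (auto simp: centralizer_def)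
  have char: "x + x = 0" for x :: 'a
    using comm[of x "x + x"] by (cases "x = 0") (auto simp: algebra_simps)
  have sq: "x * x = 0 \<or> x * x = x" for x :: 'a
    using comm[of x "x * x"] by (cases "x = 0") (auto simp: mult.assoc)
  have char': "x + (x + y) = y" for x y :: 'a
    by (simp add: char flip: add.assoc)
  have sum_eq_0: "x + y = 0 \<longleftrightarrow> x = y" for x y :: 'a
    by (metis add.right_neutral char char')
  have U: "(UNIV :: 'a set) = {0, x, y, x + y}" if "x \<noteq> 0" "y \<noteq> 0" "x \<noteq> y" for x y :: 'a
    using that by (intro card_4_UNIV card) (auto simp: sum_eq_0)
  \<comment> \<open>Multiplying \<open>x * y\<close> by \<open>x\<close> on the left gives 0. If
    \<open>x * y\<close> were \<open>y\<close> or \<open>x + y\<close>, this would give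
    \<open>x * y\<close> back, a non-zero element. The other side is symmetric.\<close>
  have nil_mult: "x * y = 0 \<or> x * y = x" "y * x = 0 \<or> y * x = x"
    if "x * x = 0" "x \<noteq> 0" "y \<noteq> 0" "x \<noteq> y" for x y :: 'a
  proof -
    have "x * (x * y) = 0" "y * x * x = 0"
      using that by (metis mult.assoc mult_zero_left mult_zero_right)+
    moreover have "x * y \<in> {0, x, y, x + y}" "y * x \<in> {0, x, y, x + y}"
      using U[OF that(2-4)] by blast+
    ultimately show "x * y = 0 \<or> x * y = x" "y * x = 0 \<or> y * x = x"
      using that by (auto simp: distrib_left distrib_right sum_eq_0)
  qed
  \<comment> \<open>If they were distinct, both products would lie in \<open>{0, x}\<close> and in
    \<open>{0, y}\<close>, hence vanish, and \<open>x\<close> and \<open>y\<close> would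
    commute.\<close>
  have nil_unique: "x = y" if "x * x = 0" "y * y = 0" "x \<noteq> 0" "y \<noteq> 0" for x y :: 'a
    using nil_mult[of x y] nil_mult[of y x] comm[of x y] that by metis
  obtain x y :: 'a where xy: "x * y \<noteq> y * x"
    using nc by blast
  then have xy0: "x \<noteq> 0" "y \<noteq> 0" "x \<noteq> y"
    by auto
  then have "x + y \<noteq> 0" "x + y \<noteq> x" "x + y \<noteq> y"
    by (auto simp: sum_eq_0)
  \<comment> \<open>At most one of \<open>x\<close>, \<open>y\<close>, \<open>x + y\<close> squares
    to zero, so two of them are idempotent.\<close>
  then obtain a b :: 'a where ab: "a \<noteq> 0" "b \<noteq> 0" "a \<noteq> b" "a * a = a" "b * b = b"
    using xy0 nil_unique sq by metis
  have mult_cases: "u * v = 0 \<or> u * v = u \<or> u * v = v"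
    if "u \<noteq> 0" "v \<noteq> 0" "u \<noteq> v" "u * u = u" for u v :: 'a
  \<comment> \<open>Only \<open>u + v\<close> has to be excluded: left multiplication by the
    idempotent \<open>u\<close> fixes \<open>u * v\<close> but sends \<open>u + v\<close> to
    \<open>u + (u + v) = v\<close>.\<close>
  proof -
    have "u * v \<noteq> u + v"
    proof
      assume sum: "u * v = u + v"
      have "u * v = u * (u * v)"
        using that by (simp flip: mult.assoc)
      also have "\<dots> = v"
        using that sum by (simp add: distrib_left char')
      finally show False
        using that sum by simp
    qed
    moreover have "u * v \<in> {0, u, v, u + v}"
      using U[OF that(1-3)] by blast
    ultimately show ?thesis
      by auto
  qed
  have mult_nonzero: "u * v \<noteq> 0"
    if uv: "u \<noteq> 0" "v \<noteq> 0" "u \<noteq> v" "u * u = u" "v * v = v" for u v :: 'a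
  proof
    assume 0: "u * v = 0"
    with mult_cases[of v u] comm[of u v] uv consider "v * u = v" | "v * u = u"
      by metis
    then show False
    \<comment> \<open>Associativity gives \<open>v = (v * u) * v = v * (u * v) = 0\<close> in the
      first case and \<open>u = u * (v * u) = (u * v) * u = 0\<close> in the second.\<close>
    proof cases
      case 1
      then show False
        using 0 uv by (metis mult.assoc mult_zero_right)
    next
      case 2
      then show False
        using 0 uv by (metis mult.assoc mult_zero_left)
    qed
  qed
  have "a * b \<noteq> b * a"
    using comm[of a b] ab by auto
  \<comment> \<open>Both products lie in \<open>{a, b}\<close> and they differ, which leaves the
    tables of E and F.\<close>
  then consider "a * b = a" "b * a = b" | "a * b = b" "b * a = a"
    using mult_cases[of a b] mult_cases[of b a] mult_nonzero[of a b] mult_nonzero[of b a] ab by metis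
  then show ?thesis
    using E_ring_iso[OF U[OF ab(1-3)] card char ab(4,5)]
      F_ring_iso[OF U[OF ab(1-3)] card char ab(4,5)] by cases simp_all
qed

theorem corollary4p11:
  assumes noncommutative: "\<exists>x y :: 'a::{finite, ring}. x * y \<noteq> y * x"
    and order: "CARD('a) \<notin> {8, 12}"
  shows "regular_graph 2 (noncommuting_graph :: 'a pair_pre_digraph) \<longleftrightarrow>
    (\<exists>f :: 'a \<Rightarrow> 2 E_ring. ring_isomorphism f) \<or> (\<exists>f :: 'a \<Rightarrow> 2 F_ring. ring_isomorphism f)"
  \<comment> \<open>The converse is pure counting: both models have order 4, which already
    characterizes 2-regularity.\<close>
  using noncommutative_ring_of_order_4[OF noncommutative]
  by (auto simp: regular_graph_2_iff_card[OF noncommutative] card_E_ring card_F_ring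
      dest!: ring_isomorphism_card)

end
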